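(* Let $G$ be a connected graph on $n$ vertices with chromatic number $\chi(G)=\chi\le n-1$, let $b_\chi=n+\lceil n/\chi\rceil$, and let $\ell_1$ be the largest color-class size in a fixed proper coloring of $G$ with exactly $\chi$ color classes. Then $$\left|\left\{i\in\{1,\dots,n\}:\partial_i^L(G)\ge b_\chi\right\}\right|\ge \ell_1-1\ge \left\lceil\frac{n}{\chi}\right\rceil-1.$$ Equivalently, $$\mu_G([0,b_\chi))\le n-\left(\left\lceil\frac{n}{\chi}\right\rceil-1\right)=n-\left\lceil\frac{n}{\chi}\right\rceil+1.$$
   Context: Graphs are finite, simple and undirected. For a connected graph $G$ with vertices $v_1,\dots,v_n$, let $d_G(u,v)$ be the length of a shortest $u$–$v$ path, $D(G)=(d_G(v_i,v_j))_{i,j}$ the distance matrix, and $\operatorname{Tr}_G(v)=\sum_{u\in V(G)}d_G(u,v)$ the transmission of $v$. The distance Laplacian matrix is $\mathcal{D}^{L}(G)=\operatorname{diag}(\operatorname{Tr}_G(v_1),\dots,\operatorname{Tr}_G(v_n))-D(G)$, a real symmetric positive semidefinite matrix with $\mathcal{D}^{L}(G)\mathbf 1=\mathbf 0$. Its eigenvalues, listed with multiplicity, are ordered $\partial^{L}_1(G)\ge\partial^{L}_2(G)\ge\cdots\ge\partial^{L}_n(G)=0$. For a real interval $I$, $\mu_G(I)$ is the number of eigenvalues of $\mathcal{D}^{L}(G)$ in $I$, counted with multiplicity. A proper coloring is a partition of $V(G)$ into nonempty independent sets (color classes); $\chi(G)$ is the least number of classes. *)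

theory Defs
  imports
    Graph_Theory.Graph_Theory
    Jordan_Normal_Form.Char_Poly
    "HOL-Library.Disjoint_Sets"
    "HOL-Library.Multiset"
begin

text \<open>
  Finite simple undirected graphs are the symmetric digraphs of the locale \<^locale>\<open>graph\<close>.
  All matrices are indexed by an enumeration \<open>vs\<close> of the vertices, that is, a
  distinct list with \<open>set vs = verts G\<close>.
\<close>

definition graph_dist :: "('a, 'b) pre_digraph \<Rightarrow> 'a \<Rightarrow> 'a \<Rightarrow> nat" where
  "graph_dist G u v = (LEAST k. \<exists>p. pre_digraph.apath G u p v \<and> length p = k)"

definition transmission :: "('a, 'b) pre_digraph \<Rightarrow> 'a \<Rightarrow> nat" where
  "transmission G v = (\<Sum>u\<in>verts G. graph_dist G u v)"

definition distance_matrix :: "('a, 'b) pre_digraph \<Rightarrow> 'a list \<Rightarrow> real mat" where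
  "distance_matrix G vs =
     mat (length vs) (length vs) (\<lambda>(i, j). real (graph_dist G (vs ! i) (vs ! j)))"

definition distance_laplacian :: "('a, 'b) pre_digraph \<Rightarrow> 'a list \<Rightarrow> real mat" where
  "distance_laplacian G vs =
     mat_diag (length vs) (\<lambda>i. real (transmission G (vs ! i))) - distance_matrix G vs"

text \<open>
  The eigenvalues with their multiplicities as roots of the characteristic polynomial. The
  matrix is real symmetric, so these are all \<open>n\<close> eigenvalues, and the algebraic
  and geometric multiplicities agree.
\<close>
definition dl_spectrum :: "('a, 'b) pre_digraph \<Rightarrow> 'a list \<Rightarrow> real multiset" where
  "dl_spectrum G vs = proots (char_poly (distance_laplacian G vs))"

text \<open>The \<open>i\<close>-th largest eigenvalue, counted from 1; meaningful for \<open>1 \<le> i \<le> n\<close> only.\<close>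
definition dl_eigenvalue :: "('a, 'b) pre_digraph \<Rightarrow> 'a list \<Rightarrow> nat \<Rightarrow> real" where
  "dl_eigenvalue G vs i = rev (sorted_list_of_multiset (dl_spectrum G vs)) ! (i - 1)"

definition dl_count :: "('a, 'b) pre_digraph \<Rightarrow> 'a list \<Rightarrow> real set \<Rightarrow> nat" where
  "dl_count G vs I = size (filter_mset (\<lambda>x. x \<in> I) (dl_spectrum G vs))"

definition independent_set :: "('a, 'b) pre_digraph \<Rightarrow> 'a set \<Rightarrow> bool" where
  "independent_set G S \<longleftrightarrow> S \<subseteq> verts G \<and> (\<forall>u\<in>S. \<forall>v\<in>S. \<not> u \<rightarrow>\<^bsub>G\<^esub> v)"

definition proper_coloring :: "('a, 'b) pre_digraph \<Rightarrow> 'a set set \<Rightarrow> bool" where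
  "proper_coloring G P \<longleftrightarrow> partition_on (verts G) P \<and> (\<forall>C\<in>P. independent_set G C)"

definition chromatic_number :: "('a, 'b) pre_digraph \<Rightarrow> nat" where
  "chromatic_number G = (LEAST k. \<exists>P. proper_coloring G P \<and> card P = k)"

end

theory Submission
  imports Defs
begin

text \<open>
  The colour classes enter only as independent sets. Let \<open>S\<close> be one of size \<open>l\<close>, and let
  \<open>L\<close> be the distance Laplacian. As for every weighted Laplacian,
  \<open>x \<bullet> L x\<close> is the sum of \<open>d(u, v) (x\<^sub>u - x\<^sub>v)\<^sup>2\<close> over the unordered pairs of vertices. Distances
  between distinct vertices are at least 1, and inside \<open>S\<close> at least 2, so this form dominates the sum of
  the form of the complete graph on all vertices and that of the complete graph on \<open>S\<close>. If \<open>x\<close>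
  vanishes outside \<open>S\<close> and its entries sum to 0, these two forms equal \<open>n |x|\<^sup>2\<close> and \<open>l |x|\<^sup>2\<close>.
  Hence \<open>x \<bullet> L x \<ge> (n + l) |x|\<^sup>2\<close> on a space of dimension \<open>l - 1\<close>
  (\<open>distance_laplacian_form_ge\<close>).

  By the Courant-Fischer principle \<open>L\<close> then has at least \<open>l - 1\<close> eigenvalues that are
  \<open>\<ge> n + l\<close>. The principle is proved here in the form of \<open>card_eigenvalues_ge\<close>, from the
  orthogonal diagonalization of real symmetric matrices
  (\<open>symmetric_orthogonally_diagonalizable\<close>).

  For a largest colour class, \<open>l \<ge> \<lceil>n / \<chi>\<rceil>\<close> because the \<open>\<chi>\<close> classes cover all \<open>n\<close> vertices, so
  \<open>n + l \<ge> b\<close>. The bound on the number of eigenvalues in \<open>[0, b)\<close> is the complementary count.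
\<close>

section \<open>Orthogonal diagonalization of real symmetric matrices\<close>

lemma symmetric_scalar_prod:
  fixes A :: "real mat"
  assumes A: "A \<in> carrier_mat n n" and sym: "transpose_mat A = A"
    and x: "x \<in> carrier_vec n" and y: "y \<in> carrier_vec n"
  shows "x \<bullet> (A *\<^sub>v y) = (A *\<^sub>v x) \<bullet> y"
  using transpose_vec_mult_scalar[OF A y x] sym by simp

lemma scalar_prod_self_eq_sum:
  fixes x :: "real vec"
  assumes "x \<in> carrier_vec n"
  shows "x \<bullet> x = (\<Sum>i<n. (x $ i)\<^sup>2)"
  using assms by (auto simp: scalar_prod_def power2_eq_square atLeast0LessThan)

lemma scalar_prod_self_pos:
  fixes x :: "real vec"
  assumes x: "x \<in> carrier_vec n" and x0: "x \<noteq> 0\<^sub>v n"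
  shows "x \<bullet> x > 0"
proof -
  obtain i where i: "i < n" "x $ i \<noteq> 0"
    using x x0 by (metis carrier_vecD eq_vecI index_zero_vec(1) index_zero_vec(2))
  then show ?thesis
    unfolding scalar_prod_self_eq_sum[OF x] by (intro sum_pos2[of _ i]) auto
qed

lemma complex_eigenvector_exists:
  fixes A :: "complex mat"
  assumes A: "A \<in> carrier_mat n n" and n: "n > 0"
  shows "\<exists>w z. eigenvector A w z"
proof -
  obtain as where as: "char_poly A = (\<Prod>a\<leftarrow>as. [:- a, 1:])" "length as = n"
    using char_poly_factorized[OF A] by blast
  obtain z bs where "as = z # bs"
    using as(2) n by (cases as) auto
  then have "poly (char_poly A) z = 0"
    unfolding as(1) by simp
  then show ?thesis
    using eigenvalue_root_char_poly[OF A] unfolding eigenvalue_def by blast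
qed

text \<open>
  Split a complex eigenvector into \<open>x + \<i> y\<close>. Symmetry, \<open>x \<bullet> A y = A x \<bullet> y\<close>, makes the imaginary
  part of the eigenvalue times \<open>|x|\<^sup>2 + |y|\<^sup>2\<close> vanish. So the eigenvalue is real, and whichever of
  \<open>x\<close> and \<open>y\<close> is nonzero is a real eigenvector.
\<close>
lemma symmetric_real_eigenvector:
  fixes A :: "real mat"
  assumes A: "A \<in> carrier_mat n n" and sym: "transpose_mat A = A" and n: "n > 0"
  shows "\<exists>v a. v \<in> carrier_vec n \<and> v \<noteq> 0\<^sub>v n \<and> A *\<^sub>v v = a \<cdot>\<^sub>v v"
proof -
  let ?C = "map_mat complex_of_real A"
  have C: "?C \<in> carrier_mat n n" using A by simp
  obtain w z where w: "w \<in> carrier_vec n" "w \<noteq> 0\<^sub>v n" "?C *\<^sub>v w = z \<cdot>\<^sub>v w"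
    using complex_eigenvector_exists[OF C n] C unfolding eigenvector_def by auto
  define x where "x = map_vec Re w"
  define y where "y = map_vec Im w"
  have x: "x \<in> carrier_vec n" and y: "y \<in> carrier_vec n"
    using w(1) by (auto simp: x_def y_def)
  have eq: "(\<Sum>j = 0..<n. complex_of_real (A $$ (i, j)) * w $ j) = z * w $ i" if "i < n" for i
    using arg_cong[OF w(3), of "\<lambda>v. v $ i"] that A w(1)
    by (auto simp: scalar_prod_def)
  have Ax: "A *\<^sub>v x = Re z \<cdot>\<^sub>v x - Im z \<cdot>\<^sub>v y"
    using A w(1) arg_cong[OF eq, of _ Re]
    by (intro eq_vecI) (auto simp: scalar_prod_def x_def y_def)
  have Ay: "A *\<^sub>v y = Re z \<cdot>\<^sub>v y + Im z \<cdot>\<^sub>v x"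
    using A w(1) arg_cong[OF eq, of _ Im]
    by (intro eq_vecI) (auto simp: scalar_prod_def x_def y_def algebra_simps)
  have "x \<noteq> 0\<^sub>v n \<or> y \<noteq> 0\<^sub>v n"
  proof (rule ccontr)
    assume H: "\<not> ?thesis"
    have "w $ i = 0" if "i < n" for i
    proof -
      have "x $ i = 0" "y $ i = 0" using H that by auto
      then show ?thesis using w(1) that by (simp add: x_def y_def complex_eq_iff)
    qed
    then show False using w(1,2) by auto
  qed
  then have pos: "x \<bullet> x + y \<bullet> y > 0"
    using scalar_prod_self_pos[OF x] scalar_prod_self_pos[OF y]
      scalar_prod_self_eq_sum[OF x] scalar_prod_self_eq_sum[OF y]
    by (metis add_pos_nonneg add_nonneg_pos sum_nonneg zero_le_power2)
  have "x \<bullet> (A *\<^sub>v y) = (A *\<^sub>v x) \<bullet> y"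
    by (rule symmetric_scalar_prod[OF A sym x y])
  then have "Im z * (x \<bullet> x + y \<bullet> y) = 0"
    unfolding Ax Ay using x y
    by (simp add: scalar_prod_add_distrib[of _ n] minus_scalar_prod_distrib[of _ n] algebra_simps)
  then have "Im z = 0" using pos by simp
  then have "A *\<^sub>v x = Re z \<cdot>\<^sub>v x" "A *\<^sub>v y = Re z \<cdot>\<^sub>v y"
    unfolding Ax Ay using x y by (auto intro!: eq_vecI)
  then show ?thesis
    using \<open>x \<noteq> 0\<^sub>v n \<or> y \<noteq> 0\<^sub>v n\<close> x y by blast
qed

text \<open>
  The reflection in the hyperplane orthogonal to \<open>v - e\<^sub>0\<close> exchanges the unit vectors \<open>v\<close> and \<open>e\<^sub>0\<close>.
  It is its own transpose and its own inverse, so conjugating with it preserves symmetry.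
\<close>
lemma householder_reflection_exists:
  fixes v :: "real vec"
  assumes v: "v \<in> carrier_vec n" and n: "n > 0" and v1: "v \<bullet> v = 1"
  shows "\<exists>W. W \<in> carrier_mat n n \<and> transpose_mat W = W \<and> W * W = 1\<^sub>m n \<and> W *\<^sub>v unit_vec n 0 = v"
proof (cases "v = unit_vec n 0")
  case True
  then show ?thesis
    by (intro exI[of _ "1\<^sub>m n"]) auto
next
  case False
  define w where "w = v - unit_vec n 0"
  define c where "c = 2 / (w \<bullet> w)"
  define W where "W = mat n n (\<lambda>(i, j). (if i = j then 1 else 0) - c * w $ i * w $ j)"
  have w: "w \<in> carrier_vec n" using v by (simp add: w_def)
  have "w \<noteq> 0\<^sub>v n"
  proof
    assume w0: "w = 0\<^sub>v n"
    have "v $ i = unit_vec n 0 $ i" if "i < n" for i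
      using arg_cong[OF w0, of "\<lambda>u. u $ i"] that v by (simp add: w_def)
    then show False using False v by auto
  qed
  then have pos: "w \<bullet> w > 0" using scalar_prod_self_pos[OF w] by simp
  \<comment> \<open>Both \<open>v\<close> and \<open>e\<^sub>0\<close> have norm 1, so \<open>|v - e\<^sub>0|\<^sup>2 = 2 - 2 v\<^sub>0\<close>.\<close>
  have ww: "w \<bullet> w = - 2 * w $ 0"
    unfolding w_def using v n v1
    by (simp add: scalar_prod_minus_distrib[of _ n] minus_scalar_prod_distrib[of _ n]
        scalar_prod_left_unit[of _ n] scalar_prod_right_unit[of _ n])
  have W: "W \<in> carrier_mat n n" by (simp add: W_def)
  have "W * W = 1\<^sub>m n"
  proof (rule eq_matI)
    fix i j assume ij: "i < dim_row (1\<^sub>m n :: real mat)" "j < dim_col (1\<^sub>m n :: real mat)"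
    then have ij: "i < n" "j < n" by auto
    \<comment> \<open>With \<open>c = 2 / |w|\<^sup>2\<close> the cross terms \<open>- 2 c w\<^sub>i w\<^sub>j\<close> cancel against \<open>c\<^sup>2 w\<^sub>i w\<^sub>j |w|\<^sup>2\<close>.\<close>
    have "(W * W) $$ (i, j) = (\<Sum>k = 0..<n. W $$ (i, k) * W $$ (k, j))"
      using ij W by (simp add: scalar_prod_def)
    also have "\<dots> = (\<Sum>k = 0..<n. (if k = i then (if k = j then 1 else 0) else 0)
        - (if k = i then c * w $ k * w $ j else 0)
        - (if k = j then c * w $ i * w $ k else 0)
        + c * c * w $ i * w $ j * (w $ k * w $ k))"
      using ij by (intro sum.cong) (auto simp: W_def algebra_simps)
    also have "\<dots> = (if i = j then 1 else 0) - 2 * c * w $ i * w $ j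
        + c * c * w $ i * w $ j * (w \<bullet> w)"
      using ij w by (simp add: sum.distrib sum_subtractf sum_distrib_left[symmetric] scalar_prod_def)
    also have "\<dots> = (if i = j then 1 else 0)"
      using pos by (simp add: c_def)
    finally show "(W * W) $$ (i, j) = 1\<^sub>m n $$ (i, j)" using ij by simp
  qed (use W in auto)
  moreover have "W *\<^sub>v unit_vec n 0 = v"
  proof (rule eq_vecI)
    fix i assume "i < dim_vec v"
    then have i: "i < n" using v by simp
    have "c * w $ 0 = -1" using ww pos by (simp add: c_def field_simps)
    then have "(if i = 0 then 1 else 0) - c * w $ i * w $ 0 = (if i = 0 then 1 else 0) + w $ i"
      by (metis diff_minus_eq_add mult.commute mult.left_commute mult_minus1_right)
    then show "(W *\<^sub>v unit_vec n 0) $ i = v $ i"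
      using i n v by (simp add: W_def w_def scalar_prod_right_unit[of _ n])
  qed (use W v in auto)
  moreover have "transpose_mat W = W"
    by (rule eq_matI) (auto simp: W_def)
  ultimately show ?thesis using W by blast
qed

text \<open>
  Deflation: conjugating \<open>A\<close> with a reflection that takes \<open>e\<^sub>0\<close> to a unit eigenvector makes \<open>e\<^sub>0\<close> an
  eigenvector. By symmetry the first row and the first column then vanish off the diagonal, and the
  induction hypothesis diagonalizes the remaining block.
\<close>
theorem symmetric_orthogonally_diagonalizable:
  fixes A :: "real mat"
  assumes "A \<in> carrier_mat n n" and "transpose_mat A = A"
  shows "\<exists>P es. P \<in> carrier_mat n n \<and> length es = n \<and> transpose_mat P * P = 1\<^sub>m n
    \<and> transpose_mat P * A * P = mat_diag n ((!) es)"
  using assms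
proof (induction n arbitrary: A)
  case 0
  then show ?case
    by (intro exI[of _ "1\<^sub>m 0"] exI[of _ "[]"]) (auto simp: mat_diag_def intro!: eq_matI)
next
  case (Suc n A)
  note A = Suc.prems(1) and sym = Suc.prems(2)
  obtain u a where u: "u \<in> carrier_vec (Suc n)" "u \<noteq> 0\<^sub>v (Suc n)" "A *\<^sub>v u = a \<cdot>\<^sub>v u"
    using symmetric_real_eigenvector[OF A sym] by auto
  define v where "v = (1 / sqrt (u \<bullet> u)) \<cdot>\<^sub>v u"
  have upos: "u \<bullet> u > 0" by (rule scalar_prod_self_pos[OF u(1,2)])
  have v: "v \<in> carrier_vec (Suc n)" using u(1) by (simp add: v_def)
  have v1: "v \<bullet> v = 1" using upos u(1) by (simp add: v_def)
  have Av: "A *\<^sub>v v = a \<cdot>\<^sub>v v"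
    unfolding v_def using A u(1,3)
    by (simp add: mult_mat_vec[of _ "Suc n" "Suc n"] smult_smult_assoc mult.commute)
  obtain W where W: "W \<in> carrier_mat (Suc n) (Suc n)" and WT: "transpose_mat W = W"
    and WW: "W * W = 1\<^sub>m (Suc n)" and We: "W *\<^sub>v unit_vec (Suc n) 0 = v"
    using householder_reflection_exists[OF v _ v1] by auto
  define B where "B = W * A * W"
  have B: "B \<in> carrier_mat (Suc n) (Suc n)" using W A by (simp add: B_def)
  have BT: "transpose_mat B = B"
    unfolding B_def using W A sym WT
    by (simp add: transpose_mult[of _ "Suc n" "Suc n" _ "Suc n"])
  have "W *\<^sub>v v = unit_vec (Suc n) 0"
    unfolding We[symmetric] using W WW
    by (simp flip: assoc_mult_mat_vec[of _ "Suc n" "Suc n" _ "Suc n"])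
  then have Be: "B *\<^sub>v unit_vec (Suc n) 0 = a \<cdot>\<^sub>v unit_vec (Suc n) 0"
    unfolding B_def using W A We Av v
    by (simp add: assoc_mult_mat_vec[of _ "Suc n" "Suc n" _ "Suc n"] mult_mat_vec[of _ "Suc n" "Suc n"])
  have B0: "B $$ (i, 0) = (if i = 0 then a else 0)" if "i < Suc n" for i
    using arg_cong[OF Be, of "\<lambda>v. v $ i"] that B by simp
  have B0': "B $$ (0, i) = (if i = 0 then a else 0)" if "i < Suc n" for i
    using B0[OF that] arg_cong[OF BT, of "\<lambda>M. M $$ (i, 0)"] that B by simp
  define C where "C = mat n n (\<lambda>(i, j). B $$ (Suc i, Suc j))"
  have C: "C \<in> carrier_mat n n" by (simp add: C_def)
  have Bsym: "B $$ (i, j) = B $$ (j, i)" if "i < Suc n" "j < Suc n" for i j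
    using arg_cong[OF BT, of "\<lambda>M. M $$ (i, j)"] that B by simp
  have CT: "transpose_mat C = C"
    by (rule eq_matI) (auto simp: C_def intro: Bsym)
  define L where "L = mat 1 1 (\<lambda>_. a)"
  have L: "L \<in> carrier_mat 1 1" by (simp add: L_def)
  have Bblock: "B = four_block_mat L (0\<^sub>m 1 n) (0\<^sub>m n 1) C"
    using B B0 B0' by (intro eq_matI) (auto simp: C_def L_def)
  obtain P es where P: "P \<in> carrier_mat n n" "length es = n" "transpose_mat P * P = 1\<^sub>m n"
    "transpose_mat P * C * P = mat_diag n ((!) es)"
    using Suc.IH[OF C CT] by blast
  define F where "F = four_block_mat (1\<^sub>m 1) (0\<^sub>m 1 n) (0\<^sub>m n 1) P"
  have F: "F \<in> carrier_mat (Suc n) (Suc n)"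
    using four_block_carrier_mat[OF one_carrier_mat[of 1] P(1)] by (simp add: F_def)
  have FT: "transpose_mat F = four_block_mat (1\<^sub>m 1) (0\<^sub>m 1 n) (0\<^sub>m n 1) (transpose_mat P)"
    unfolding F_def using P(1)
    by (subst transpose_four_block_mat[of _ 1 1 _ n _ n]) auto
  have FF: "transpose_mat F * F = 1\<^sub>m (Suc n)"
    unfolding FT unfolding F_def using P(1,3)
    by (subst mult_four_block_mat[of _ 1 1 _ n _ n _ _ 1 _ n]) auto
  have "transpose_mat F * B = four_block_mat L (0\<^sub>m 1 n) (0\<^sub>m n 1) (transpose_mat P * C)"
    unfolding FT Bblock using P(1) C L
    by (subst mult_four_block_mat[of _ 1 1 _ n _ n _ _ 1 _ n]) auto
  then have "transpose_mat F * B * F = four_block_mat L (0\<^sub>m 1 n) (0\<^sub>m n 1) (mat_diag n ((!) es))"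
    unfolding F_def using P C L
    by simp (subst mult_four_block_mat[of _ 1 1 _ n _ n _ _ 1 _ n], auto)
  also have "\<dots> = mat_diag (Suc n) ((!) (a # es))"
    by (rule eq_matI) (auto simp: L_def mat_diag_def)
  finally have FBF: "transpose_mat F * B * F = mat_diag (Suc n) ((!) (a # es))" .
  define Q where "Q = W * F"
  have Q: "Q \<in> carrier_mat (Suc n) (Suc n)" using W F by (simp add: Q_def)
  have QT: "transpose_mat Q = transpose_mat F * W"
    unfolding Q_def using W F WT by (simp add: transpose_mult[of _ "Suc n" "Suc n" _ "Suc n"])
  have FTc: "transpose_mat F \<in> carrier_mat (Suc n) (Suc n)" using F by simp
  note assoc = assoc_mult_mat[of _ "Suc n" "Suc n" _ "Suc n" _ "Suc n"]
  have "transpose_mat Q * Q = transpose_mat F * ((W * W) * F)"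
    unfolding QT unfolding Q_def using W F FTc by (simp add: assoc)
  then have "transpose_mat Q * Q = 1\<^sub>m (Suc n)"
    using WW F FF by simp
  moreover have "transpose_mat Q * A * Q = transpose_mat F * B * F"
    unfolding QT unfolding Q_def B_def using W F FTc A by (simp add: assoc)
  ultimately show ?case
    using Q FBF P(2) by (intro exI[of _ Q] exI[of _ "a # es"]) auto
qed

section \<open>Counting eigenvalues by the values of the quadratic form\<close>

lemma proots_prod_list_linear: "proots (\<Prod>e\<leftarrow>es. [:- e, 1:]) = mset (es :: 'a :: idom list)"
proof (induction es)
  case (Cons e es)
  have "(\<Prod>e\<leftarrow>es. [:- e, 1:]) \<noteq> (0 :: 'a poly)"
    by (auto simp: prod_list_zero_iff)
  then have "proots ([:- e, 1:] * (\<Prod>e\<leftarrow>es. [:- e, 1:])) = {#e#} + mset es"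
    by (subst proots_mult) (auto simp: Cons.IH)
  then show ?case by simp
qed auto

text \<open>
  Links the diagonal entries to the multiset of roots by which the spectrum is defined: similar
  matrices have the same characteristic polynomial.
\<close>
lemma orthogonal_diagonalization_spectrum:
  fixes A P :: "real mat"
  assumes A: "A \<in> carrier_mat n n" and P: "P \<in> carrier_mat n n" and es: "length es = n"
    and PP: "transpose_mat P * P = 1\<^sub>m n"
    and D: "transpose_mat P * A * P = mat_diag n ((!) es)"
  shows "proots (char_poly A) = mset es"
proof -
  let ?D = "mat_diag n ((!) es)"
  have PT: "transpose_mat P \<in> carrier_mat n n" using P by simp
  have "P * transpose_mat P = 1\<^sub>m n"
    by (rule mat_mult_left_right_inverse[OF PT P PP])
  then have "similar_mat_wit ?D A (transpose_mat P) P"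
    using PP D A P PT by (intro similar_mat_witI[of _ _ n]) auto
  then have "char_poly A = char_poly ?D"
    using char_poly_similar[of ?D A] unfolding similar_mat_def by metis
  also have "\<dots> = (\<Prod>e\<leftarrow>diag_mat ?D. [:- e, 1:])"
    by (rule char_poly_upper_triangular[of _ n]) (auto simp: mat_diag_def)
  also have "diag_mat ?D = es"
    using es by (intro nth_equalityI) (auto simp: diag_mat_def mat_diag_def)
  finally show ?thesis by (simp add: proots_prod_list_linear)
qed

text \<open>
  Padded with zero rows to a square matrix, the system has determinant 0 and hence a nontrivial kernel.
\<close>
lemma homogeneous_system_nonzero_solution:
  fixes cs :: "real vec list"
  assumes cs: "set cs \<subseteq> carrier_vec n" and less: "length cs < n"
  shows "\<exists>x. x \<in> carrier_vec n \<and> x \<noteq> 0\<^sub>v n \<and> (\<forall>c\<in>set cs. c \<bullet> x = 0)"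
proof -
  define f where "f i = (if i < length cs then cs ! i else 0\<^sub>v n)" for i
  define M where "M = mat\<^sub>r n n (\<lambda>i. if i = length cs then 0\<^sub>v n else f i)"
  have f: "f i \<in> carrier_vec n" for i
    using cs by (auto simp: f_def)
  have M: "M \<in> carrier_mat n n" by (simp add: M_def)
  have "det M = 0"
    unfolding M_def by (rule det_row_0[OF less]) (use f in auto)
  then obtain x where x: "x \<in> carrier_vec n" "x \<noteq> 0\<^sub>v n" "M *\<^sub>v x = 0\<^sub>v n"
    using det_0_iff_vec_prod_zero[OF M] by blast
  have "cs ! i \<bullet> x = 0" if "i < length cs" for i
  proof -
    have "row M i = cs ! i"
      using that less f[of i] by (simp add: M_def f_def)
    then show ?thesis
      using arg_cong[OF x(3), of "\<lambda>v. v $ i"] that less M by simp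
  qed
  then show ?thesis
    using x by (metis in_set_conv_nth)
qed

text \<open>
  The half of the Courant-Fischer principle that bounds eigenvalues from below, for the orthogonal
  complement of \<open>cs\<close>, whose dimension is at least \<open>n - length cs\<close>. If there were too few
  eigenvalues \<open>\<ge> b\<close>, then some nonzero vector of this subspace would also be orthogonal to all their eigenvectors. It would be a
  combination of eigenvectors with eigenvalues \<open>< b\<close>, and its quadratic form would be too small.
\<close>
lemma card_eigenvalues_ge:
  fixes A :: "real mat"
  assumes A: "A \<in> carrier_mat n n" and sym: "transpose_mat A = A"
    and cs: "set cs \<subseteq> carrier_vec n"
    and form: "\<And>x. x \<in> carrier_vec n \<Longrightarrow> (\<forall>c\<in>set cs. c \<bullet> x = 0) \<Longrightarrow>
      b * (x \<bullet> x) \<le> x \<bullet> (A *\<^sub>v x)"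
  shows "n \<le> size {#e \<in># proots (char_poly A). b \<le> e#} + length cs"
proof (rule ccontr)
  assume H: "\<not> ?thesis"
  obtain P es where P: "P \<in> carrier_mat n n" and es: "length es = n"
    and PP: "transpose_mat P * P = 1\<^sub>m n"
    and D: "transpose_mat P * A * P = mat_diag n ((!) es)"
    using symmetric_orthogonally_diagonalizable[OF A sym] by blast
  define big where "big = filter (\<lambda>i. b \<le> es ! i) [0..<n]"
  have "size {#e \<in># proots (char_poly A). b \<le> e#} = length (filter ((\<le>) b) es)"
    by (simp add: orthogonal_diagonalization_spectrum[OF A P es PP D] flip: mset_filter)
  also have "\<dots> = length big"
    unfolding big_def length_filter_conv_card es
    by (subst distinct_card[symmetric]) (auto intro!: arg_cong[of _ _ card])
  finally have "length (map (col P) big @ cs) < n"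
    using H by simp
  moreover have "set (map (col P) big @ cs) \<subseteq> carrier_vec n"
    using cs P by auto
  ultimately obtain x where x: "x \<in> carrier_vec n" "x \<noteq> 0\<^sub>v n"
    and orth: "\<And>c. c \<in> set (map (col P) big @ cs) \<Longrightarrow> c \<bullet> x = 0"
    using homogeneous_system_nonzero_solution by blast
  let ?D = "mat_diag n ((!) es)"
  \<comment> \<open>The coordinates of \<open>x\<close> in the orthonormal basis of eigenvectors.\<close>
  define y where "y = transpose_mat P *\<^sub>v x"
  have PT: "transpose_mat P \<in> carrier_mat n n" using P by simp
  have PPT: "P * transpose_mat P = 1\<^sub>m n"
    by (rule mat_mult_left_right_inverse[OF PT P PP])
  have y: "y \<in> carrier_vec n" using PT x(1) by (simp add: y_def)
  have xy: "P *\<^sub>v y = x"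
    unfolding y_def using P PT x(1) PPT
    by (simp flip: assoc_mult_mat_vec[of _ n n _ n])
  have xP: "x \<bullet> (P *\<^sub>v z) = y \<bullet> z" if "z \<in> carrier_vec n" for z
    unfolding y_def by (rule transpose_vec_mult_scalar[OF P that x(1), symmetric])
  have "transpose_mat P *\<^sub>v (A *\<^sub>v (P *\<^sub>v y)) = ?D *\<^sub>v y"
    unfolding D[symmetric] using P PT A y
    by (simp add: assoc_mult_mat_vec[of _ n n _ n])
  then have Dy: "transpose_mat P *\<^sub>v (A *\<^sub>v x) = ?D *\<^sub>v y"
    unfolding xy .
  have "x \<bullet> (A *\<^sub>v x) = (A *\<^sub>v x) \<bullet> (P *\<^sub>v y)"
    unfolding xy using A x(1) by (intro comm_scalar_prod[of _ n]) auto
  also have "\<dots> = (transpose_mat P *\<^sub>v (A *\<^sub>v x)) \<bullet> y"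
    using transpose_vec_mult_scalar[OF P y, of "A *\<^sub>v x"] A x(1) by simp
  also have "\<dots> = (\<Sum>i<n. es ! i * (y $ i)\<^sup>2)"
    unfolding Dy using y
    by (auto simp: scalar_prod_def mat_diag_def power2_eq_square atLeast0LessThan
        if_distrib[of "\<lambda>u. u * _"] cong: if_cong intro!: sum.cong)
  finally have Ax: "x \<bullet> (A *\<^sub>v x) = (\<Sum>i<n. es ! i * (y $ i)\<^sup>2)" .
  have xx: "x \<bullet> x = (\<Sum>i<n. (y $ i)\<^sup>2)"
    using xP[OF y] unfolding xy by (simp add: scalar_prod_self_eq_sum[OF y])
  have y0: "y $ i = 0" if "i < n" "b \<le> es ! i" for i
    using orth[of "col P i"] that P by (simp add: y_def big_def)
  have "y \<noteq> 0\<^sub>v n"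
    using xy x(2) P by auto
  then obtain k where k: "k < n" "y $ k \<noteq> 0"
    using y by (metis carrier_vecD eq_vecI index_zero_vec(1) index_zero_vec(2))
  have "(\<Sum>i<n. es ! i * (y $ i)\<^sup>2) < (\<Sum>i<n. b * (y $ i)\<^sup>2)"
  proof (rule sum_strict_mono_ex1)
    show "\<forall>i\<in>{..<n}. es ! i * (y $ i)\<^sup>2 \<le> b * (y $ i)\<^sup>2"
      using y0 by (metis lessThan_iff linorder_le_cases mult_right_mono mult_zero_right order_refl
          power_zero_numeral zero_le_power2)
    show "\<exists>i\<in>{..<n}. es ! i * (y $ i)\<^sup>2 < b * (y $ i)\<^sup>2"
      using k y0[OF k(1)] by (intro bexI[of _ k]) (auto simp: not_le[symmetric])
  qed simp
  then have "x \<bullet> (A *\<^sub>v x) < b * (x \<bullet> x)"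
    unfolding Ax xx by (simp add: sum_distrib_left)
  then show False
    using form[OF x(1)] orth by force
qed

section \<open>Distances in symmetric digraphs\<close>

context wf_digraph
begin

text \<open>
  Removing cycles shortens a walk. Therefore the distance, defined by paths without repeated vertices,
  is bounded by the length of any walk, and comparing distances needs only walks.
\<close>
lemma length_awalk_to_apath_le:
  assumes "awalk u p v"
  shows "length (awalk_to_apath p) \<le> length p"
  using assms
proof (induct rule: awalk_to_apath_induct)
  case (path p)
  then have "awalk_to_apath p = p"
    by (auto simp: awalk_to_apath.simps)
  then show ?case by simp
next
  case (decomp p q r s)
  then have "p = q @ r @ s"
    using awalk_cyc_decomp_has_prop[of u p v] by auto
  then show ?case
    using decomp step_awalk_to_apath[of u p v q r s] by simp
qed

lemma graph_dist_le_awalk: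
  assumes "awalk u p v"
  shows "graph_dist G u v \<le> length p"
proof -
  have "graph_dist G u v \<le> length (awalk_to_apath p)"
    unfolding graph_dist_def
    by (rule Least_le) (use apath_awalk_to_apath[OF assms] in blast)
  then show ?thesis
    using length_awalk_to_apath_le[OF assms] by simp
qed

lemma graph_dist_attained:
  assumes "u \<rightarrow>\<^sup>* v"
  shows "\<exists>p. apath u p v \<and> length p = graph_dist G u v"
  unfolding graph_dist_def
  by (rule LeastI_ex) (use assms reachable_apath in blast)

lemma graph_dist_pos:
  assumes "u \<rightarrow>\<^sup>* v" and "u \<noteq> v"
  shows "graph_dist G u v \<ge> 1"
proof -
  obtain p where p: "apath u p v" "length p = graph_dist G u v"
    using graph_dist_attained[OF assms(1)] by blast
  have "p \<noteq> []" using p(1) assms(2) by (auto simp: apath_Nil_iff)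
  then show ?thesis using p(2) by (cases p) auto
qed

lemma graph_dist_nonadjacent:
  assumes uv: "u \<rightarrow>\<^sup>* v" and "u \<noteq> v" and "\<not> u \<rightarrow> v"
  shows "graph_dist G u v \<ge> 2"
proof (rule ccontr)
  assume "\<not> ?thesis"
  then have "graph_dist G u v = 1"
    using graph_dist_pos[OF uv \<open>u \<noteq> v\<close>] by simp
  then obtain e where "apath u [e] v"
    using graph_dist_attained[OF uv] by (auto simp: length_Suc_conv)
  then have "u \<rightarrow> v"
    by (auto simp: apath_simps intro: in_arcs_imp_in_arcs_ends)
  then show False using assms(3) by simp
qed

end

text \<open>
  The reversed walk uses, for each arc, the opposite arc that symmetry provides. This is what makes
  the distance, and with it the distance matrix, symmetric.
\<close>
lemma (in sym_digraph) awalk_reverse: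
  assumes "awalk u p v"
  shows "\<exists>q. awalk v q u \<and> length q = length p"
  using assms
proof (induction p arbitrary: u)
  case Nil
  then show ?case by (auto simp: awalk_Nil_iff)
next
  case (Cons e p)
  then have e: "e \<in> arcs G" "tail G e = u" and p: "awalk (head G e) p v"
    by (auto simp: awalk_Cons_iff)
  obtain q where q: "awalk v q (head G e)" "length q = length p"
    using Cons.IH[OF p] by blast
  obtain f where f: "f \<in> arcs G" "tail G f = head G e" "head G f = tail G e"
    using sym_arcs[unfolded symmetric_conv, rule_format, OF e(1)] by auto
  have "awalk (head G e) [f] u"
    using arc_implies_awalk[OF f(1)] f e by simp
  then have "awalk v (q @ [f]) u"
    by (rule awalk_appendI[OF q(1)])
  then show ?case using q(2) by (intro exI[of _ "q @ [f]"]) simp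
qed

lemma (in sym_digraph) graph_dist_commute:
  assumes "u \<rightarrow>\<^sup>* v"
  shows "graph_dist G u v = graph_dist G v u"
proof -
  have le: "graph_dist G y x \<le> graph_dist G x y" if xy: "x \<rightarrow>\<^sup>* y" for x y
  proof -
    obtain p where p: "apath x p y" "length p = graph_dist G x y"
      using graph_dist_attained[OF xy] by blast
    obtain q where q: "awalk y q x" "length q = length p"
      using awalk_reverse[OF awalkI_apath[OF p(1)]] by blast
    show ?thesis
      using graph_dist_le_awalk[OF q(1)] p(2) q(2) by simp
  qed
  show ?thesis
    using le[OF assms] le[OF symmetric_reachable'[OF assms]] by simp
qed

section \<open>The quadratic form of the distance Laplacian\<close>

text \<open>
  The quadratic form of the Laplacian of a complete graph with edge weights \<open>d\<close>. The factor 2 appears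
  because the double sum runs over ordered pairs.
\<close>
lemma laplacian_quadratic_form:
  fixes d :: "'i \<Rightarrow> 'i \<Rightarrow> real"
  assumes "\<And>i j. i \<in> A \<Longrightarrow> j \<in> A \<Longrightarrow> d i j = d j i"
  shows "2 * (\<Sum>i\<in>A. x i * (\<Sum>j\<in>A. d i j * (x i - x j)))
    = (\<Sum>i\<in>A. \<Sum>j\<in>A. d i j * (x i - x j)\<^sup>2)"
proof -
  let ?s = "\<Sum>i\<in>A. \<Sum>j\<in>A. d i j * x i * (x i - x j)"
  have "(\<Sum>i\<in>A. \<Sum>j\<in>A. d i j * (x i - x j)\<^sup>2)
      = ?s + (\<Sum>i\<in>A. \<Sum>j\<in>A. d i j * x j * (x j - x i))"
    unfolding sum.distrib[symmetric]
    by (intro sum.cong refl) (simp add: power2_eq_square algebra_simps)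
  also have "(\<Sum>i\<in>A. \<Sum>j\<in>A. d i j * x j * (x j - x i)) = ?s"
    by (subst sum.swap) (intro sum.cong refl, simp add: assms)
  also have "?s = (\<Sum>i\<in>A. x i * (\<Sum>j\<in>A. d i j * (x i - x j)))"
    by (simp add: sum_distrib_left algebra_simps)
  finally show ?thesis by simp
qed

text \<open>
  The case of unit weights: on vectors whose entries sum to 0, the Laplacian of the complete graph
  acts as multiplication by the number of vertices.
\<close>
lemma sum_squared_differences:
  fixes x :: "'i \<Rightarrow> real"
  shows "(\<Sum>i\<in>A. \<Sum>j\<in>A. (x i - x j)\<^sup>2)
    = 2 * real (card A) * (\<Sum>i\<in>A. (x i)\<^sup>2) - 2 * (\<Sum>i\<in>A. x i)\<^sup>2"
proof -
  have "(\<Sum>i\<in>A. \<Sum>j\<in>A. (x i - x j)\<^sup>2)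
      = (\<Sum>i\<in>A. \<Sum>j\<in>A. (x i)\<^sup>2) + (\<Sum>i\<in>A. \<Sum>j\<in>A. (x j)\<^sup>2) - 2 * (\<Sum>i\<in>A. \<Sum>j\<in>A. x i * x j)"
    by (simp add: power2_diff sum.distrib sum_subtractf sum_distrib_left mult.assoc)
  also have "(\<Sum>i\<in>A. \<Sum>j\<in>A. x i * x j) = (\<Sum>i\<in>A. x i)\<^sup>2"
    by (simp add: power2_eq_square sum_product)
  finally show ?thesis
    by (simp add: sum_distrib_left[symmetric])
qed

lemma distance_laplacian_carrier:
  "distance_laplacian G vs \<in> carrier_mat (length vs) (length vs)"
  unfolding distance_laplacian_def distance_matrix_def by (intro minus_carrier_mat) simp

context graph
begin

lemma connected_imp_reachable:
  assumes "Digraph_Component.connected G" and "u \<in> verts G" and "v \<in> verts G"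
  shows "u \<rightarrow>\<^sup>* v"
  using symmetric_connected_imp_strongly_connected[OF sym_arcs assms(1)] assms(2,3)
  by (auto simp: strongly_connected_def)

lemma distance_laplacian_symmetric:
  assumes "Digraph_Component.connected G" and "set vs = verts G"
  shows "transpose_mat (distance_laplacian G vs) = distance_laplacian G vs"
proof -
  have "graph_dist G (vs ! i) (vs ! j) = graph_dist G (vs ! j) (vs ! i)"
    if "i < length vs" "j < length vs" for i j
    by (rule graph_dist_commute, rule connected_imp_reachable) (use assms that nth_mem in blast)+
  then show ?thesis
    by (intro eq_matI) (auto simp: distance_laplacian_def distance_matrix_def mat_diag_def)
qed

text \<open>
  Since \<open>d(u, v) \<ge> 1 + [u, v \<in> S]\<close> for \<open>u \<noteq> v\<close>, the form dominates those of the complete graphs on all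
  vertices and on \<open>S\<close>. On \<open>x\<close> they give the two summands of the factor on the left.
\<close>
lemma distance_laplacian_form_ge:
  assumes conn: "Digraph_Component.connected G" and vs: "distinct vs" "set vs = verts G"
    and S: "independent_set G S" and x: "x \<in> carrier_vec (length vs)"
    and supp: "\<And>i. i < length vs \<Longrightarrow> vs ! i \<notin> S \<Longrightarrow> x $ i = 0"
    and sum0: "(\<Sum>i<length vs. x $ i) = 0"
  shows "real (length vs + card S) * (x \<bullet> x) \<le> x \<bullet> (distance_laplacian G vs *\<^sub>v x)"
proof -
  let ?n = "length vs"
  define d where "d i j = real (graph_dist G (vs ! i) (vs ! j))" for i j
  define I where "I = {i. i < ?n \<and> vs ! i \<in> S}"
  have reach: "vs ! i \<rightarrow>\<^sup>* vs ! j" if "i < ?n" "j < ?n" for i j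
    by (rule connected_imp_reachable[OF conn]) (use vs(2) that nth_mem in blast)+
  have dsym: "d i j = d j i" if "i < ?n" "j < ?n" for i j
    using graph_dist_commute[OF reach[OF that]] by (simp add: d_def)
  have bij: "bij_betw ((!) vs) {..<?n} (verts G)"
    using bij_betw_nth[OF vs(1), of "{..<?n}" "verts G"] vs(2) by simp
  have trans: "real (transmission G (vs ! i)) = (\<Sum>j<?n. d i j)" if "i < ?n" for i
  proof -
    have "real (transmission G (vs ! i)) = (\<Sum>j<?n. d j i)"
      unfolding transmission_def d_def by (simp flip: sum.reindex_bij_betw[OF bij])
    then show ?thesis using dsym that by simp
  qed
  have "S \<subseteq> verts G" using S by (simp add: independent_set_def)
  then have "bij_betw ((!) vs) I S"
    using bij unfolding I_def bij_betw_def by (auto simp: inj_on_def image_iff)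
  then have cardI: "card I = card S" by (rule bij_betw_same_card)
  have I: "I \<subseteq> {..<?n}" by (auto simp: I_def)
  have x0: "x $ i = 0" if "i \<in> {..<?n} - I" for i
    using supp that by (auto simp: I_def)
  have sumI: "(\<Sum>i\<in>I. x $ i) = 0"
    using sum.mono_neutral_left[OF _ I, of "\<lambda>i. x $ i"] x0 sum0 by auto
  have sqI: "(\<Sum>i\<in>I. (x $ i)\<^sup>2) = x \<bullet> x"
    unfolding scalar_prod_self_eq_sum[OF x]
    using sum.mono_neutral_left[OF _ I, of "\<lambda>i. (x $ i)\<^sup>2"] x0 by auto
  have Lx: "(distance_laplacian G vs *\<^sub>v x) $ i = (\<Sum>j<?n. d i j * (x $ i - x $ j))"
    if i: "i < ?n" for i
  proof -
    have "(distance_laplacian G vs *\<^sub>v x) $ i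
        = (\<Sum>j<?n. ((if i = j then \<Sum>k<?n. d i k else 0) - d i j) * x $ j)"
      using i x trans
      by (auto simp: distance_laplacian_def distance_matrix_def mat_diag_def scalar_prod_def
          atLeast0LessThan d_def intro!: sum.cong)
    also have "\<dots> = (\<Sum>j<?n. (if j = i then (\<Sum>k<?n. d i k) * x $ i else 0) - d i j * x $ j)"
      by (intro sum.cong) (auto simp: algebra_simps)
    also have "\<dots> = (\<Sum>k<?n. d i k) * x $ i - (\<Sum>j<?n. d i j * x $ j)"
      using i by (simp add: sum_subtractf)
    also have "\<dots> = (\<Sum>j<?n. d i j * (x $ i - x $ j))"
      by (simp add: sum_distrib_right right_diff_distrib sum_subtractf)
    finally show ?thesis .
  qed
  have weight: "1 + (if i \<in> I \<and> j \<in> I then 1 else 0) \<le> d i j" if "i < ?n" "j < ?n" "i \<noteq> j" for i j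
  proof -
    have ne: "vs ! i \<noteq> vs ! j" using that vs(1) by (simp add: nth_eq_iff_index_eq)
    show ?thesis
    proof (cases "i \<in> I \<and> j \<in> I")
      case True
      then have "\<not> vs ! i \<rightarrow> vs ! j" using S by (simp add: independent_set_def I_def)
      then show ?thesis
        using True graph_dist_nonadjacent[OF reach[OF that(1,2)] ne] by (simp add: d_def)
    next
      case False
      then show ?thesis
        using graph_dist_pos[OF reach[OF that(1,2)] ne] by (auto simp: d_def)
    qed
  qed
  have "(\<Sum>i<?n. \<Sum>j<?n. (x $ i - x $ j)\<^sup>2) + (\<Sum>i\<in>I. \<Sum>j\<in>I. (x $ i - x $ j)\<^sup>2)
      = (\<Sum>i<?n. \<Sum>j<?n. (1 + (if i \<in> I \<and> j \<in> I then 1 else 0)) * (x $ i - x $ j)\<^sup>2)"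
  proof -
    have "(\<Sum>i<?n. \<Sum>j<?n. (if i \<in> I \<and> j \<in> I then (x $ i - x $ j)\<^sup>2 else 0))
        = (\<Sum>i<?n. if i \<in> I then \<Sum>j<?n. if j \<in> I then (x $ i - x $ j)\<^sup>2 else 0 else 0)"
      by (intro sum.cong) auto
    also have "\<dots> = (\<Sum>i\<in>{..<?n} \<inter> I. \<Sum>j\<in>{..<?n} \<inter> I. (x $ i - x $ j)\<^sup>2)"
      by (simp add: sum.inter_restrict)
    also have "{..<?n} \<inter> I = I" using I by blast
    finally show ?thesis
      by (simp add: distrib_right sum.distrib if_distrib[of "\<lambda>u. u * _"] cong: if_cong)
  qed
  also have "\<dots> \<le> (\<Sum>i<?n. \<Sum>j<?n. d i j * (x $ i - x $ j)\<^sup>2)"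
  proof (intro sum_mono)
    fix i j assume "i \<in> {..<?n}" "j \<in> {..<?n}"
    then show "(1 + (if i \<in> I \<and> j \<in> I then 1 else 0)) * (x $ i - x $ j)\<^sup>2
        \<le> d i j * (x $ i - x $ j)\<^sup>2"
      by (cases "i = j") (simp, intro mult_right_mono weight, simp_all)
  qed
  also have "\<dots> = 2 * (\<Sum>i<?n. x $ i * (\<Sum>j<?n. d i j * (x $ i - x $ j)))"
    by (rule laplacian_quadratic_form[symmetric]) (use dsym in auto)
  also have "\<dots> = 2 * (x \<bullet> (distance_laplacian G vs *\<^sub>v x))"
    using Lx by (simp add: scalar_prod_def distance_laplacian_def distance_matrix_def atLeast0LessThan)
  finally show ?thesis
    unfolding sum_squared_differences
    by (simp add: sum0 sumI sqI cardI distrib_right flip: scalar_prod_self_eq_sum[OF x])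
qed

text \<open>
  The space used in \<open>distance_laplacian_form_ge\<close> is cut out by one equation \<open>x\<^sub>v = 0\<close> for each vertex
  outside \<open>S\<close> and the equation that the entries sum to 0, which leaves dimension at least
  \<open>card S - 1\<close>.
\<close>
lemma independent_set_eigenvalues:
  assumes conn: "Digraph_Component.connected G" and vs: "distinct vs" "set vs = verts G"
    and S: "independent_set G S"
  shows "card S \<le> size {#e \<in># dl_spectrum G vs. real (card (verts G) + card S) \<le> e#} + 1"
proof -
  let ?n = "length vs"
  have n: "?n = card (verts G)" using vs distinct_card by metis
  define out where "out = filter (\<lambda>i. vs ! i \<notin> S) [0..<?n]"
  define cs :: "real vec list" where "cs = map (unit_vec ?n) out @ [vec ?n (\<lambda>_. 1)]"
  have "length out = length (filter (\<lambda>v. v \<notin> S) vs)"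
    unfolding out_def length_filter_conv_card by (auto intro!: arg_cong[of _ _ card])
  also have "\<dots> = card (verts G - S)"
    using vs distinct_card[of "filter (\<lambda>v. v \<notin> S) vs"] by (simp add: set_diff_eq)
  also have "\<dots> = card (verts G) - card S"
    using S finite_verts by (intro card_Diff_subset) (auto simp: independent_set_def intro: finite_subset)
  finally have len: "length cs = ?n - card S + 1"
    by (simp add: cs_def n)
  have "card S \<le> ?n"
    unfolding n using S by (intro card_mono) (auto simp: independent_set_def)
  moreover have "?n \<le> size {#e \<in># proots (char_poly (distance_laplacian G vs)).
      real (?n + card S) \<le> e#} + length cs"
  proof (rule card_eigenvalues_ge)
    show "distance_laplacian G vs \<in> carrier_mat ?n ?n"
      by (rule distance_laplacian_carrier)
    show "transpose_mat (distance_laplacian G vs) = distance_laplacian G vs"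
      by (rule distance_laplacian_symmetric[OF conn vs(2)])
    show "set cs \<subseteq> carrier_vec ?n" by (auto simp: cs_def)
    fix x :: "real vec"
    assume x: "x \<in> carrier_vec ?n" and orth: "\<forall>c\<in>set cs. c \<bullet> x = 0"
    have "x $ i = 0" if "i < ?n" "vs ! i \<notin> S" for i
      using orth that x scalar_prod_left_unit[of x ?n i] by (auto simp: cs_def out_def)
    moreover have "(\<Sum>i<?n. x $ i) = 0"
      using orth x by (auto simp: cs_def scalar_prod_def atLeast0LessThan)
    ultimately show "real (?n + card S) * (x \<bullet> x) \<le> x \<bullet> (distance_laplacian G vs *\<^sub>v x)"
      by (rule distance_laplacian_form_ge[OF conn vs S x])
  qed
  ultimately show ?thesis
    unfolding dl_spectrum_def n[symmetric] len by linarith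
qed

end

section \<open>Eigenvalue counts and colour classes\<close>

lemma size_dl_spectrum_le: "size (dl_spectrum G vs) \<le> length vs"
  unfolding dl_spectrum_def
  using size_proots_le degree_monic_char_poly[OF distance_laplacian_carrier] by metis

text \<open>
  Passes from the multiset of eigenvalues to their decreasing enumeration. The bound on the size of the
  spectrum keeps every list position inside \<open>{1..length vs}\<close>.
\<close>
lemma size_filter_le_card_dl_eigenvalue:
  "size {#e \<in># dl_spectrum G vs. b \<le> e#} \<le> card {i \<in> {1..length vs}. b \<le> dl_eigenvalue G vs i}"
proof -
  define xs where "xs = rev (sorted_list_of_multiset (dl_spectrum G vs))"
  have mset: "mset xs = dl_spectrum G vs" by (simp add: xs_def)
  have len: "length xs \<le> length vs"
    using size_dl_spectrum_le[of G vs] by (simp flip: mset)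
  have "size {#e \<in># dl_spectrum G vs. b \<le> e#} = card {i. i < length xs \<and> b \<le> xs ! i}"
    unfolding mset[symmetric] by (simp add: length_filter_conv_card flip: mset_filter)
  also have "\<dots> = card (Suc ` {i. i < length xs \<and> b \<le> xs ! i})"
    by (simp add: card_image)
  also have "\<dots> \<le> card {i \<in> {1..length vs}. b \<le> dl_eigenvalue G vs i}"
    using len by (intro card_mono) (auto simp: dl_eigenvalue_def xs_def)
  finally show ?thesis .
qed

text \<open>
  The pigeonhole principle behind \<open>\<lceil>n / \<chi>\<rceil> \<le> l\<close>.
\<close>
lemma card_le_card_partition_times_Max:
  assumes P: "partition_on A P" and A: "finite A"
  shows "card A \<le> card P * Max (card ` P)"
proof -
  have finP: "finite P" by (rule finite_elements[OF A P])
  have "card A = (\<Sum>C\<in>P. card C)"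
    using partition_onD1[OF P] partition_onD2[OF P] A
    by (metis card_Union_disjoint disjoint_def finite_UnionD finite_Union Sup_upper finite_subset pairwiseI disjnt_def)
  also have "\<dots> \<le> (\<Sum>C\<in>P. Max (card ` P))"
    using finP by (intro sum_mono) simp
  finally show ?thesis by simp
qed

theorem corollary3p2:
  fixes G :: "('a, 'b) pre_digraph" and vs :: "'a list" and P :: "'a set set"
    and n chi l1 :: nat and b :: real
  assumes "graph G" and "Digraph_Component.connected G"
    and "distinct vs" and "set vs = verts G"
    and "n = card (verts G)"
    and "chi = chromatic_number G" and "chi \<le> n - 1"
    and "b = real n + of_int \<lceil>real n / real chi\<rceil>"
    and "proper_coloring G P" and "card P = chi"
    and "l1 = Max (card ` P)"
  shows "int (card {i \<in> {1..n}. dl_eigenvalue G vs i \<ge> b}) \<ge> int l1 - 1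
    \<and> int l1 - 1 \<ge> \<lceil>real n / real chi\<rceil> - 1
    \<and> int (dl_count G vs {0..<b}) \<le> int n - (\<lceil>real n / real chi\<rceil> - 1)
    \<and> int n - (\<lceil>real n / real chi\<rceil> - 1) = int n - \<lceil>real n / real chi\<rceil> + 1"
proof -
  interpret graph G by fact
  have part: "partition_on (verts G) P" and ind: "\<And>C. C \<in> P \<Longrightarrow> independent_set G C"
    using assms(9) by (auto simp: proper_coloring_def)
  have len: "length vs = n" using assms(3-5) distinct_card by metis
  have finP: "finite P" by (rule finite_elements[OF finite_verts part])
  have "verts G \<noteq> {}"
    using symmetric_connected_imp_strongly_connected[OF sym_arcs assms(2)]
    by (simp add: strongly_connected_def)
  then have P0: "P \<noteq> {}" using partition_onD1[OF part] by auto
  then have chi0: "chi > 0" using finP assms(10) by auto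
  obtain S where S: "S \<in> P" "card S = l1"
    using Max_in[of "card ` P"] finP P0 assms(11) by (metis empty_is_image finite_imageI imageE)
  have "n \<le> chi * l1"
    using card_le_card_partition_times_Max[OF part finite_verts] assms(5,10,11) by simp
  then have "real n \<le> real chi * real l1" by (metis of_nat_le_iff of_nat_mult)
  then have ceil: "\<lceil>real n / real chi\<rceil> \<le> int l1"
    using chi0 by (simp add: ceiling_le_iff field_simps)
  then have b: "b \<le> real (n + l1)" unfolding assms(8) by simp
  let ?big = "{#e \<in># dl_spectrum G vs. b \<le> e#}"
  have "l1 \<le> size {#e \<in># dl_spectrum G vs. real (n + l1) \<le> e#} + 1"
    using independent_set_eigenvalues[OF assms(2-4) ind[OF S(1)]] S(2) assms(5) by simp
  also have "size {#e \<in># dl_spectrum G vs. real (n + l1) \<le> e#} \<le> size ?big"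
    using b by (intro size_mset_mono filter_mset_mono_strong) auto
  finally have big: "l1 \<le> size ?big + 1" by simp
  have count: "size ?big \<le> card {i \<in> {1..n}. b \<le> dl_eigenvalue G vs i}"
    using size_filter_le_card_dl_eigenvalue[of b G vs] len by simp
  have "dl_count G vs {0..<b} \<le> size {#e \<in># dl_spectrum G vs. \<not> b \<le> e#}"
    unfolding dl_count_def by (intro size_mset_mono filter_mset_mono_strong) auto
  moreover have "size ?big + size {#e \<in># dl_spectrum G vs. \<not> b \<le> e#} = size (dl_spectrum G vs)"
    by (metis multiset_partition size_union)
  ultimately have "dl_count G vs {0..<b} + size ?big \<le> n"
    using size_dl_spectrum_le[of G vs] len by linarith
  then show ?thesis
    using big count ceil by linarith
qed

end
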